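(* Let $f\in\mathcal{U}$ be given by $f(z)=z+\sum_{n=2}^{\infty}a_nz^n$. Then $$|a_n^2-a_{2n-1}|\le (n-1)^2\quad\text{for all } n\ge 2.$$ This inequality is sharp, with equality for the Koebe function and its rotations, i.e., for functions of the form $f(z)=z/(1-xz)^2$ where $|x|=1$.
   Context: $\mathbb{D}=\{z\in\mathbb{C}:|z|<1\}$ is the unit disk. $\mathcal{A}$ is the class of analytic functions $f$ on $\mathbb{D}$ with $f(0)=0$ and $f'(0)=1$. $\mathcal{U}$ is the class of functions $f\in\mathcal{A}$ satisfying $$\left|f'(z)\left(\frac{z}{f(z)}\right)^2-1\right|<1\quad\text{for all } z\in\mathbb{D};$$ here functions in $\mathcal{U}$ are non-vanishing in $\mathbb{D}\setminus\{0\}$, and $z/f(z)$ is understood to take the value $1$ at $z=0$. The Koebe function is $k(z)=z/(1-z)^2$. *)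

theory Defs
  imports "HOL-Complex_Analysis.Complex_Analysis"
begin

abbreviation unit_disk :: "complex set" ("\<D>") where
  "\<D> \<equiv> ball 0 1"

definition class_A :: "(complex \<Rightarrow> complex) set" where
  "class_A = {f. f analytic_on \<D> \<and> f 0 = 0 \<and> deriv f 0 = 1}"

text \<open>The function \<open>z / f z\<close>, with its removable singularity at the origin filled in
  (for \<open>f\<close> with \<open>f 0 = 0\<close> and \<open>deriv f 0 = 1\<close>); plain HOL division would give \<open>0 / 0 = 0\<close>.\<close>

definition z_over :: "(complex \<Rightarrow> complex) \<Rightarrow> complex \<Rightarrow> complex" where
  "z_over f z = (if z = 0 then 1 else z / f z)"

text \<open>Non-vanishing off the origin is implicit in the usual formulation, where \<open>z / f z\<close> has to
  be defined; since division is total in HOL it is made explicit.\<close>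

definition class_U :: "(complex \<Rightarrow> complex) set" where
  "class_U = {f \<in> class_A.
     (\<forall>z\<in>\<D> - {0}. f z \<noteq> 0) \<and>
     (\<forall>z\<in>\<D>. cmod (deriv f z * (z_over f z)\<^sup>2 - 1) < 1)}"

text \<open>\<open>f(z) = z + a\<^sub>2 z\<^sup>2 + a\<^sub>3 z\<^sup>3 + \<dots>\<close> on the unit disk; the values
  \<open>a 0\<close> and \<open>a 1\<close> are irrelevant.\<close>

definition has_expansion :: "(complex \<Rightarrow> complex) \<Rightarrow> (nat \<Rightarrow> complex) \<Rightarrow> bool" where
  "has_expansion f a \<longleftrightarrow> (\<forall>z\<in>\<D>. (\<lambda>n. a (n + 2) * z ^ (n + 2)) sums (f z - z))"

definition koebe :: "complex \<Rightarrow> complex" where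
  "koebe z = z / (1 - z)\<^sup>2"

definition koebe_rotation :: "complex \<Rightarrow> complex \<Rightarrow> complex" where
  "koebe_rotation x z = z / (1 - x * z)\<^sup>2"

lemma koebe_rotation_1: "koebe_rotation 1 = koebe"
  by (simp add: fun_eq_iff koebe_rotation_def koebe_def)

lemma koebe_rotation_eq: "x \<noteq> 0 \<Longrightarrow> koebe_rotation x z = koebe (x * z) / x"
  by (simp add: koebe_rotation_def koebe_def)

end

theory Submission imports Defs begin

text \<open>
Put \<open>p z = z / f z\<close>.  The inequality that defines the class reads \<open>cmod (p z - z * deriv p z - 1) < 1\<close>, and the
proof draws two kinds of information from it.

First, \<open>p = q\<^sup>2\<close> with \<open>cmod (1 - q z) < 1\<close> (lemma \<open>sqrt_in_disk\<close>), that is, \<open>f z / z\<close> is subordinate to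
\<open>1 / (1 - z)\<^sup>2\<close>.  It follows that the mean \<open>h z = 1 + (\<Sum>n\<ge>1. a (n + 1) / (n + 1) * z ^ n)\<close> of \<open>f z / z\<close> has
real part greater than \<open>1 / 2\<close> (lemma \<open>average_in_half_plane\<close>).  Both facts come from Jack's lemma on a point where an
analytic function first reaches the unit circle.  For the coefficients \<open>c n = a (n + 1) / (n + 1)\<close> of \<open>h\<close> there is the
inequality \<open>cmod (c (2 * m) - (c m)\<^sup>2) \<le> 1 - (cmod (c m))\<^sup>2\<close> (lemma \<open>livingston_inequality\<close>), a form of the
Schwarz--Pick lemma.  With \<open>m = n - 1\<close>,
\<open>(a n)\<^sup>2 - a (2 * n - 1) = (n - 1)\<^sup>2 * (c m)\<^sup>2 - (2 * n - 1) * (c (2 * m) - (c m)\<^sup>2)\<close>,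
and this is at most \<open>max ((n - 1)\<^sup>2) (2 * n - 1)\<close> in modulus, which settles \<open>n \<ge> 4\<close>.

For \<open>n = 2\<close> and \<open>n = 3\<close> the maximum is \<open>2 * n - 1\<close> and the subordination alone is too weak.  Here the coefficients
\<open>b n\<close> of \<open>p\<close> are used.  The inequality for \<open>p\<close> says that \<open>b 2\<close>, \<open>2 * b 3\<close>, \<open>3 * b 4\<close>, \<dots> are, up to sign, the
coefficients of a function bounded by \<open>1\<close>, so the Schwarz--Pick lemma bounds the later ones in terms of \<open>b 2\<close>.  Now
\<open>(a 2)\<^sup>2 - a 3 = b 2\<close>, and \<open>(a 3)\<^sup>2 - a 5 = (b 1)\<^sup>2 * b 2 - 2 * b 1 * b 3 + b 4\<close>.  The latter is at most \<open>4\<close> in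
modulus once the relation \<open>3 * (cmod (b 1))\<^sup>2 / 4 \<le> 2 + cmod (b 2)\<close> is added, which comes from \<open>p = q\<^sup>2\<close>.
\<close>

unbundle no vec_syntax
unbundle fps_syntax

section \<open>Coefficients of bounded functions on the disk\<close>

lemma disk_expansion:
  assumes "f holomorphic_on \<D>"
  shows "f has_fps_expansion fps_expansion f 0"
  using assms by (intro has_fps_expansion_fps_expansion[of \<D>]) auto

lemma disk_expansion_unique:
  assumes "f has_fps_expansion F" "g has_fps_expansion G"
    and "\<And>z. z \<in> \<D> \<Longrightarrow> f z = g z"
  shows "F = G"
proof -
  have "eventually (\<lambda>z. z \<in> \<D>) (nhds (0::complex))"
    by (intro eventually_nhds_in_open) auto
  hence "eventually (\<lambda>z. f z = g z) (nhds 0)"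
    by eventually_elim (use assms(3) in auto)
  hence "g has_fps_expansion F"
    using assms(1) has_fps_expansion_cong[of f g F F] by simp
  thus ?thesis
    using assms(2) fps_expansion_unique_complex by blast
qed

text \<open>Cauchy's estimate on the circle of radius \<open>r\<close>, as \<open>r\<close> tends to \<open>1\<close>; \<open>f\<close> may
have no continuous extension to the unit circle.\<close>

lemma bounded_coeff_le_1:
  assumes hol: "f holomorphic_on \<D>" and bd: "\<And>z. z \<in> \<D> \<Longrightarrow> cmod (f z) \<le> 1"
    and F: "f has_fps_expansion F"
  shows "cmod (F $ n) \<le> 1"
proof -
  have bound: "cmod (F $ n) * r ^ n \<le> 1" if "0 < r" "r < 1" for r
  proof -
    have "cmod ((deriv ^^ n) f 0) \<le> fact n * 1 / r ^ n"
    proof (rule Cauchy_inequality)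
      show "f holomorphic_on ball 0 r"
        using hol by (rule holomorphic_on_subset) (use that in auto)
      show "continuous_on (cball 0 r) f"
        by (rule continuous_on_subset[OF holomorphic_on_imp_continuous_on[OF hol]])
           (use that in auto)
    qed (use that bd in auto)
    hence "cmod (F $ n) \<le> 1 / r ^ n"
      by (simp add: fps_nth_fps_expansion[OF F] norm_divide field_simps)
    thus ?thesis using that by (simp add: field_simps)
  qed
  have "((\<lambda>r. cmod (F $ n) * r ^ n) \<longlongrightarrow> cmod (F $ n) * 1 ^ n) (at_left 1)"
    by (intro tendsto_intros)
  moreover have "eventually (\<lambda>r. cmod (F $ n) * r ^ n \<le> 1) (at_left (1::real))"
    using eventually_at_left_real[of 0 "1::real"] by (auto elim!: eventually_mono intro: bound)
  ultimately have "cmod (F $ n) * 1 ^ n \<le> 1"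
    by (intro tendsto_upperbound) auto
  thus ?thesis by simp
qed

text \<open>Dividing by \<open>z\<close> as long as the constant coefficient vanishes keeps the bound, by Schwarz's
lemma.  The quotient may be a constant of modulus \<open>1\<close>, which is why the bounds are not strict.\<close>

lemma factor_power_of_bounded:
  assumes "f holomorphic_on \<D>" and "\<And>z. z \<in> \<D> \<Longrightarrow> cmod (f z) \<le> 1"
    and "f has_fps_expansion F" and "\<And>k. k < m \<Longrightarrow> F $ k = 0"
  shows "\<exists>g. g holomorphic_on \<D> \<and> (\<forall>z\<in>\<D>. cmod (g z) \<le> 1) \<and> (\<forall>z\<in>\<D>. f z = z ^ m * g z)"
  using assms(4)
proof (induction m)
  case 0
  thus ?case using assms by auto
next
  case (Suc m)
  then obtain g where g: "g holomorphic_on \<D>" "\<And>z. z \<in> \<D> \<Longrightarrow> cmod (g z) \<le> 1"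
      "\<And>z. z \<in> \<D> \<Longrightarrow> f z = z ^ m * g z"
    by force
  have "F = fps_X ^ m * fps_expansion g 0"
    by (rule disk_expansion_unique[OF assms(3) _ g(3)])
       (intro fps_expansion_intros disk_expansion g(1), auto)
  with Suc.prems[of m] have "fps_expansion g 0 $ 0 = 0"
    by (simp add: fps_X_power_mult_nth)
  hence g0: "g 0 = 0"
    using has_fps_expansion_imp_0_eq_fps_nth_0[OF disk_expansion[OF g(1)]] by simp
  obtain h where h: "h holomorphic_on \<D>" "\<And>z. cmod z < 1 \<Longrightarrow> g z = z * h z"
    using Schwarz3[OF g(1) g0] by metis
  \<comment> \<open>Schwarz's lemma wants values in the open disk, so it is applied
    to \<open>t * g\<close> with \<open>t < 1\<close>.\<close>
  have schwarz: "cmod (g z) \<le> cmod z" if z: "z \<in> \<D>" for z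
  proof -
    have *: "t * cmod (g z) \<le> cmod z" if t: "0 < t" "t < 1" for t
    proof -
      have "cmod (of_real t * g z) \<le> cmod z"
      proof (rule Schwarz_Lemma(1)[where f = "\<lambda>z. of_real t * g z"])
        show "(\<lambda>z. of_real t * g z) holomorphic_on \<D>"
          by (intro holomorphic_intros g)
        show "cmod (of_real t * g w) < 1" if w: "cmod w < 1" for w
        proof -
          have "t * cmod (g w) \<le> t * 1"
            using g(2)[of w] w t by (intro mult_left_mono) auto
          also have "t * 1 < 1" using t by simp
          finally show ?thesis using t by (simp add: norm_mult)
        qed
      qed (use z g0 in auto)
      thus ?thesis using t by (simp add: norm_mult)
    qed
    have "((\<lambda>t. t * cmod (g z)) \<longlongrightarrow> 1 * cmod (g z)) (at_left 1)"
      by (intro tendsto_intros)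
    moreover have "eventually (\<lambda>t. t * cmod (g z) \<le> cmod z) (at_left (1::real))"
      using eventually_at_left_real[of 0 "1::real"] by (auto elim!: eventually_mono intro: *)
    ultimately have "1 * cmod (g z) \<le> cmod z"
      by (intro tendsto_upperbound) auto
    thus ?thesis by simp
  qed
  have h_off_0: "cmod (h z) \<le> 1" if "z \<in> \<D> - {0}" for z
    using schwarz[of z] h(2)[of z] that by (simp add: norm_mult)
  have "cmod (h 0) \<le> 1"
  proof (rule tendsto_upperbound)
    have "isCont h 0"
      using h(1) by (intro continuous_on_interior[of \<D>] holomorphic_on_imp_continuous_on) auto
    thus "((\<lambda>z. cmod (h z)) \<longlongrightarrow> cmod (h 0)) (at 0)"
      by (intro tendsto_norm) (simp add: isCont_def)
    have "eventually (\<lambda>z. z \<in> \<D> - {0}) (at (0::complex))"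
      by (intro eventually_at_in_open) auto
    thus "eventually (\<lambda>z. cmod (h z) \<le> 1) (at 0)"
      by eventually_elim (rule h_off_0)
  qed auto
  with h_off_0 have "\<forall>z\<in>\<D>. cmod (h z) \<le> 1" by (metis Diff_iff singletonD)
  moreover have "\<forall>z\<in>\<D>. f z = z ^ Suc m * h z"
    using g(3) h(2) by (simp add: mult_ac)
  ultimately show ?case using h(1) by blast
qed

lemma sum_root_unity_powers:
  fixes m n :: nat
  assumes m: "m \<ge> 1"
  defines "\<omega> \<equiv> exp (2 * of_real pi * \<i> / of_nat m)"
  shows "(\<Sum>j<m. (\<omega> ^ j) ^ n) = (if m dvd n then of_nat m else 0)"
proof -
  have pow: "\<omega> ^ n = exp (2 * of_real pi * \<i> * of_nat n / of_nat m)" for n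
    unfolding \<omega>_def exp_of_nat_mult[symmetric] by (simp add: field_simps)
  have "(\<Sum>j<m. (\<omega> ^ j) ^ n) = (\<Sum>j<m. (\<omega> ^ n) ^ j)"
    by (simp add: power_mult[symmetric] mult.commute)
  also have "\<dots> = (if m dvd n then of_nat m else 0)"
  proof (cases "m dvd n")
    case True
    hence "\<omega> ^ n = 1" unfolding pow using complex_root_unity_eq_1[OF m, of n] by simp
    thus ?thesis using True by simp
  next
    case False
    hence ne: "\<omega> ^ n \<noteq> 1" unfolding pow using complex_root_unity_eq_1[OF m, of n] by simp
    have "\<omega> ^ m = 1" unfolding pow using complex_root_unity_eq_1[OF m, of m] by simp
    hence "(\<omega> ^ n) ^ m = 1" by (metis mult.commute power_mult power_one)
    thus ?thesis using False ne by (simp add: geometric_sum)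
  qed
  finally show ?thesis .
qed

text \<open>Averaging \<open>f\<close> over the rotations by \<open>m\<close>-th roots of unity deletes every coefficient whose index is
not a multiple of \<open>m\<close>, and what remains is a function \<open>K\<close> of \<open>z ^ m\<close>.  The values of \<open>K\<close> are averages
of values of \<open>f\<close>, so they stay in any convex set that contains the latter.  Thereby statements
about the first coefficients carry over to the coefficients with index \<open>m\<close> and \<open>2 * m\<close>.\<close>

lemma multisection:
  assumes hol: "f holomorphic_on \<D>" and F: "f has_fps_expansion F"
    and C: "convex C" "\<And>z. z \<in> \<D> \<Longrightarrow> f z \<in> C" and m: "m \<ge> 1"
  shows "\<exists>K. K holomorphic_on \<D> \<and> (\<forall>z\<in>\<D>. K z \<in> C) \<and>
             K has_fps_expansion Abs_fps (\<lambda>k. F $ (m * k))"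
proof -
  define G where "G = Abs_fps (\<lambda>k. F $ (m * k))"
  define \<omega> where "\<omega> = exp (2 * of_real pi * \<i> / of_nat m)"
  have norm_\<omega>: "cmod \<omega> = 1" by (simp add: \<omega>_def)
  define A where "A z = (\<Sum>j<m. (1 / real m) *\<^sub>R f (\<omega> ^ j * z))" for z
  have rot: "\<omega> ^ j * z \<in> \<D>" if "z \<in> \<D>" for j z
    using that norm_\<omega> by (simp add: norm_mult norm_power)
  have A_in: "A z \<in> C" if "z \<in> \<D>" for z
    unfolding A_def by (rule convex_sum) (use C m rot[OF that] in auto)
  have sums_A: "(\<lambda>k. G $ k * (z ^ m) ^ k) sums A z" if z: "z \<in> \<D>" for z
  proof -
    have "(\<lambda>n. F $ n * w ^ n) sums f w" if "w \<in> \<D>" for w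
    proof (rule has_fps_expansion_imp_sums_complex[OF F, of "ereal 1"])
      show "f holomorphic_on eball 0 (ereal 1)" unfolding eball_ereal by (rule hol)
    qed (use that in auto)
    hence "(\<lambda>n. \<Sum>j<m. (1 / real m) *\<^sub>R (F $ n * (\<omega> ^ j * z) ^ n)) sums A z"
      unfolding A_def using rot[OF z] by (intro sums_sum sums_scaleR_right) auto
    also have "(\<lambda>n. \<Sum>j<m. (1 / real m) *\<^sub>R (F $ n * (\<omega> ^ j * z) ^ n)) =
               (\<lambda>n. if m dvd n then F $ n * z ^ n else 0)"
    proof
      fix n
      have "(\<Sum>j<m. (1 / real m) *\<^sub>R (F $ n * (\<omega> ^ j * z) ^ n)) =
            (\<Sum>j<m. (\<omega> ^ j) ^ n) * (F $ n * z ^ n) / of_nat m"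
        unfolding sum_distrib_right sum_divide_distrib
        by (intro sum.cong refl) (simp add: scaleR_conv_of_real power_mult_distrib)
      also have "\<dots> = (if m dvd n then F $ n * z ^ n else 0)"
        using sum_root_unity_powers[OF m, of n] m by (simp add: \<omega>_def)
      finally show "(\<Sum>j<m. (1 / real m) *\<^sub>R (F $ n * (\<omega> ^ j * z) ^ n)) =
            (if m dvd n then F $ n * z ^ n else 0)" .
    qed
    finally have "(\<lambda>n. if m dvd n then F $ n * z ^ n else 0) sums A z" .
    moreover have "strict_mono (\<lambda>k. m * k)" using m by (auto intro!: strict_monoI)
    ultimately have "(\<lambda>k. if m dvd m * k then F $ (m * k) * z ^ (m * k) else 0) sums A z"
      by (subst sums_mono_reindex[where f = "\<lambda>n. if m dvd n then F $ n * z ^ n else 0"])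
         (auto elim!: dvdE)
    thus ?thesis by (simp add: G_def power_mult)
  qed
  have root: "\<exists>z\<in>\<D>. z ^ m = \<zeta>" if "\<zeta> \<in> \<D>" for \<zeta> :: complex
  proof -
    obtain z where z: "z ^ m = \<zeta>"
      using exists_complex_root[of m \<zeta>] m by auto
    have "\<not> cmod z \<ge> 1"
      using that z one_le_power[of "cmod z" m] by (auto simp: norm_power[symmetric])
    with z show ?thesis by auto
  qed
  have rad: "fps_conv_radius G \<ge> 1"
    unfolding fps_conv_radius_def
  proof (rule conv_radius_geI_ex')
    fix r :: real assume r: "0 < r" "ereal r < 1"
    then obtain z where "z \<in> \<D>" "z ^ m = of_real r" using root[of "of_real r"] by auto
    thus "summable (\<lambda>n. G $ n * of_real r ^ n)"
      using sums_A[of z] by (auto simp: sums_iff)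
  qed
  have "ereal (cmod z) < fps_conv_radius G" if "z \<in> \<D>" for z
    by (rule less_le_trans[OF _ rad]) (use that in simp)
  hence "eval_fps G holomorphic_on \<D>"
    by (intro holomorphic_on_eval_fps) auto
  moreover have "eval_fps G has_fps_expansion G"
    by (rule eval_fps_has_fps_expansion) (rule less_le_trans[OF _ rad], simp)
  moreover have "eval_fps G \<zeta> \<in> C" if "\<zeta> \<in> \<D>" for \<zeta>
  proof -
    obtain z where "z \<in> \<D>" "z ^ m = \<zeta>" using root \<open>\<zeta> \<in> \<D>\<close> by blast
    thus ?thesis using sums_A[of z] A_in[of z] by (auto simp: sums_iff eval_fps_def)
  qed
  ultimately show ?thesis unfolding G_def by blast
qed

lemma moebius_bound:
  fixes a b :: complex
  assumes "cmod a \<le> 1" "cmod b \<le> 1"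
  shows "cmod (a - b) \<le> cmod (1 - cnj b * a)"
proof -
  have "(cmod (1 - cnj b * a))\<^sup>2 - (cmod (a - b))\<^sup>2 = (1 - (cmod a)\<^sup>2) * (1 - (cmod b)\<^sup>2)"
    unfolding cmod_power2 by (simp add: algebra_simps power2_eq_square)
  moreover have "(1 - (cmod a)\<^sup>2) * (1 - (cmod b)\<^sup>2) \<ge> 0"
    using assms by (intro mult_nonneg_nonneg) (auto simp: abs_square_le_1)
  ultimately have "(cmod (a - b))\<^sup>2 \<le> (cmod (1 - cnj b * a))\<^sup>2" by linarith
  thus ?thesis by (rule power2_le_imp_le) simp
qed

text \<open>For \<open>n = 1\<close> this is the Schwarz--Pick lemma at the origin: the Moebius map that moves \<open>G $ 0\<close> to
\<open>0\<close> turns \<open>g\<close> into a bounded function whose first coefficient is \<open>G $ 1 / (1 - (cmod (G $ 0))\<^sup>2)\<close>.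
Multisection reduces every other \<open>n\<close> to that case.\<close>

lemma schwarz_pick_coeff:
  assumes hol: "g holomorphic_on \<D>" and bd: "\<And>z. z \<in> \<D> \<Longrightarrow> cmod (g z) \<le> 1"
    and G: "g has_fps_expansion G" and n: "n \<ge> 1"
  shows "cmod (G $ n) \<le> 1 - (cmod (G $ 0))\<^sup>2"
proof -
  obtain K where K: "K holomorphic_on \<D>" "\<And>z. z \<in> \<D> \<Longrightarrow> cmod (K z) \<le> 1"
      "K has_fps_expansion Abs_fps (\<lambda>k. G $ (n * k))"
    using multisection[OF hol G convex_cball[of 0 1] _ n] bd by auto
  have K0: "K 0 = G $ 0"
    using has_fps_expansion_imp_0_eq_fps_nth_0[OF K(3)] by simp
  have G0: "cmod (G $ 0) \<le> 1" using K(2)[of 0] K0 by simp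
  \<comment> \<open>If \<open>cmod (G $ 0) = 1\<close> then the Moebius map degenerates; the factor \<open>t < 1\<close> avoids this case.\<close>
  have *: "t * cmod (G $ n) \<le> 1 - t\<^sup>2 * (cmod (G $ 0))\<^sup>2" if t: "0 < t" "t < 1" for t :: real
  proof -
    define c where "c = of_real t * G $ 0"
    define L where "L z = of_real t * K z" for z
    have holL: "L holomorphic_on \<D>" unfolding L_def by (intro holomorphic_intros K)
    have bdL: "cmod (L z) < 1" if z: "z \<in> \<D>" for z
    proof -
      have "t * cmod (K z) \<le> t * 1" using K(2)[OF z] t by (intro mult_left_mono) auto
      also have "t * 1 < 1" using t by simp
      finally show ?thesis using t by (simp add: L_def norm_mult)
    qed
    have L0: "L 0 = c" by (simp add: L_def c_def K0)
    have c: "cmod c < 1" using bdL[of 0] L0 by simp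
    define FL where "FL = fps_const (of_real t) * Abs_fps (\<lambda>k. G $ (n * k))"
    have FL: "L has_fps_expansion FL"
      unfolding L_def FL_def by (intro fps_expansion_intros K)
    have den: "1 - cnj c * L z \<noteq> 0" if "z \<in> \<D>" for z
    proof
      assume "1 - cnj c * L z = 0"
      hence "cmod (cnj c * L z) = 1" by (metis eq_iff_diff_eq_0 norm_one)
      moreover have "cmod (cnj c * L z) \<le> cmod c * 1"
        unfolding norm_mult complex_mod_cnj using bdL[OF that] by (intro mult_left_mono) auto
      ultimately show False using c by simp
    qed
    define M where "M z = (L z - c) / (1 - cnj c * L z)" for z
    have holM: "M holomorphic_on \<D>"
      unfolding M_def by (intro holomorphic_intros holL) (use den in auto)
    have bdM: "cmod (M z) \<le> 1" if "z \<in> \<D>" for z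
      using moebius_bound[of "L z" c] bdL[OF that] c den[OF that]
      by (simp add: M_def norm_divide)
    define FM where "FM = fps_expansion M 0"
    have FM: "M has_fps_expansion FM" unfolding FM_def by (rule disk_expansion[OF holM])
    have FM0: "FM $ 0 = 0"
      using has_fps_expansion_imp_0_eq_fps_nth_0[OF FM] L0 by (simp add: M_def)
    have "FM * (1 - fps_const (cnj c) * FL) = FL - fps_const c"
    proof (rule disk_expansion_unique)
      show "(\<lambda>z. M z * (1 - cnj c * L z)) has_fps_expansion FM * (1 - fps_const (cnj c) * FL)"
        by (intro fps_expansion_intros FM FL)
      show "(\<lambda>z. L z - c) has_fps_expansion FL - fps_const c"
        by (intro fps_expansion_intros FL)
    qed (use den in \<open>auto simp: M_def\<close>)
    hence "(FM * (1 - fps_const (cnj c) * FL)) $ 1 = (FL - fps_const c) $ 1" by simp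
    hence "FM $ 1 * (1 - cnj c * c) = of_real t * G $ n"
      by (simp add: fps_mult_nth FM0 FL_def c_def)
    moreover have "1 - cnj c * c = of_real (1 - (cmod c)\<^sup>2)"
      by (simp add: complex_norm_square[symmetric] mult.commute)
    ultimately have "cmod (of_real t * G $ n) = cmod (FM $ 1) * cmod (of_real (1 - (cmod c)\<^sup>2))"
      by (metis norm_mult)
    also have "\<dots> = cmod (FM $ 1) * (1 - (cmod c)\<^sup>2)"
      unfolding norm_of_real using c by (simp add: abs_square_le_1)
    also have "\<dots> \<le> 1 * (1 - (cmod c)\<^sup>2)"
      using bounded_coeff_le_1[OF holM bdM FM] c
      by (intro mult_right_mono) (auto simp: abs_square_le_1)
    finally show ?thesis using t by (simp add: norm_mult c_def power_mult_distrib)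
  qed
  have "t * cmod (G $ n) + t\<^sup>2 * (cmod (G $ 0))\<^sup>2 \<le> 1" if "0 < t" "t < 1" for t :: real
    using *[OF that] by simp
  hence "eventually (\<lambda>t. t * cmod (G $ n) + t\<^sup>2 * (cmod (G $ 0))\<^sup>2 \<le> 1) (at_left (1::real))"
    using eventually_at_left_real[of 0 "1::real"] by (auto elim!: eventually_mono)
  moreover have "((\<lambda>t. t * cmod (G $ n) + t\<^sup>2 * (cmod (G $ 0))\<^sup>2) \<longlongrightarrow>
      1 * cmod (G $ n) + 1\<^sup>2 * (cmod (G $ 0))\<^sup>2) (at_left 1)"
    by (intro tendsto_intros)
  ultimately have "1 * cmod (G $ n) + 1\<^sup>2 * (cmod (G $ 0))\<^sup>2 \<le> 1"
    by (intro tendsto_upperbound) auto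
  thus ?thesis by simp
qed

text \<open>For \<open>m = 1\<close>: the values of \<open>h\<close> lie in the half-plane exactly if \<open>(h z - 1) / h z = z * g z\<close> is bounded
by \<open>1\<close>.  Then \<open>g\<close> is bounded too, its first two coefficients are \<open>H $ 1\<close> and \<open>H $ 2 - (H $ 1)\<^sup>2\<close>,
and the Schwarz--Pick inequality for them is the claim.  Multisection gives the general case.\<close>

lemma livingston_inequality:
  assumes hol: "h holomorphic_on \<D>" and re: "\<And>z. z \<in> \<D> \<Longrightarrow> Re (h z) \<ge> 1 / 2"
    and H: "h has_fps_expansion H" and H0: "H $ 0 = 1" and m: "m \<ge> 1"
  shows "cmod (H $ (2 * m) - (H $ m)\<^sup>2) \<le> 1 - (cmod (H $ m))\<^sup>2"
proof -
  obtain K where K: "K holomorphic_on \<D>" "\<And>z. z \<in> \<D> \<Longrightarrow> Re (K z) \<ge> 1 / 2"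
      "K has_fps_expansion Abs_fps (\<lambda>k. H $ (m * k))"
    using multisection[OF hol H convex_halfspace_Re_ge[of "1/2"] _ m] re by auto
  have nz: "K z \<noteq> 0" if "z \<in> \<D>" for z using K(2)[OF that] by auto
  define \<psi> where "\<psi> z = (K z - 1) / K z" for z
  have hol\<psi>: "\<psi> holomorphic_on \<D>"
    unfolding \<psi>_def by (intro holomorphic_intros K) (use nz in auto)
  have bd\<psi>: "cmod (\<psi> z) \<le> 1" if "z \<in> \<D>" for z
  proof -
    have "(cmod (K z - 1))\<^sup>2 \<le> (cmod (K z))\<^sup>2"
      unfolding cmod_power2 using K(2)[OF that] by (simp add: power2_eq_square algebra_simps)
    thus ?thesis using nz[OF that] by (simp add: \<psi>_def norm_divide power2_le_iff_abs_le)
  qed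
  have K0: "K 0 = 1"
    using has_fps_expansion_imp_0_eq_fps_nth_0[OF K(3)] H0 by simp
  have "fps_expansion \<psi> 0 $ 0 = 0"
    using has_fps_expansion_imp_0_eq_fps_nth_0[OF disk_expansion[OF hol\<psi>]] K0
    by (simp add: \<psi>_def)
  then obtain g where g: "g holomorphic_on \<D>" "\<And>z. z \<in> \<D> \<Longrightarrow> cmod (g z) \<le> 1"
      "\<And>z. z \<in> \<D> \<Longrightarrow> \<psi> z = z * g z"
    using factor_power_of_bounded[OF hol\<psi> bd\<psi> disk_expansion[OF hol\<psi>], of 1] by auto
  define G where "G = fps_expansion g 0"
  have G: "g has_fps_expansion G" unfolding G_def by (rule disk_expansion[OF g(1)])
  have "Abs_fps (\<lambda>k. H $ (m * k)) * (1 - fps_X * G) = 1"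
  proof (rule disk_expansion_unique)
    show "(\<lambda>z. K z * (1 - z * g z)) has_fps_expansion
            Abs_fps (\<lambda>k. H $ (m * k)) * (1 - fps_X * G)"
      by (intro fps_expansion_intros K G)
    show "(\<lambda>z. 1) has_fps_expansion (1 :: complex fps)" by (intro fps_expansion_intros)
    show "K z * (1 - z * g z) = 1" if "z \<in> \<D>" for z
      unfolding g(3)[OF that, symmetric] using nz[OF that] by (simp add: \<psi>_def field_simps)
  qed
  hence eq: "Abs_fps (\<lambda>k. H $ (m * k)) = 1 + Abs_fps (\<lambda>k. H $ (m * k)) * (fps_X * G)"
    by (simp add: algebra_simps)
  have "H $ m = G $ 0"
    using arg_cong[OF eq, of "\<lambda>F. F $ 1"] H0 by (simp add: fps_mult_nth)
  moreover have "H $ (2 * m) = G $ 1 + H $ m * G $ 0"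
    using arg_cong[OF eq, of "\<lambda>F. F $ 2"] H0
    by (simp add: fps_mult_nth numeral_2_eq_2 mult.commute)
  ultimately have "H $ (2 * m) - (H $ m)\<^sup>2 = G $ 1" "H $ m = G $ 0"
    by (simp_all add: power2_eq_square)
  thus ?thesis using schwarz_pick_coeff[OF g(1,2) G, of 1] by simp
qed

section \<open>The boundary lemma of Jack and two subordinations\<close>

text \<open>A point of smallest modulus at which \<open>u\<close> reaches the level \<open>c\<close>.\<close>

lemma first_contact:
  fixes u :: "complex \<Rightarrow> real"
  assumes cont: "continuous_on \<D> u" and u0: "u 0 < c" and z1: "z1 \<in> \<D>" "u z1 \<ge> c"
  obtains z0 where "z0 \<in> \<D>" "z0 \<noteq> 0" "u z0 = c" "\<And>z. z \<in> ball 0 (cmod z0) \<Longrightarrow> u z < c"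
proof -
  define S where "S = {z \<in> cball 0 (cmod z1). c \<le> u z}"
  have sub: "cball 0 (cmod z1) \<subseteq> \<D>" using z1 by auto
  have "closed S"
    unfolding S_def by (intro continuous_closed_preimage_constant
        continuous_on_closed_Collect_le continuous_intros continuous_on_subset[OF cont sub]) auto
  moreover have "bounded S"
    by (rule bounded_subset[OF bounded_cball[of 0 "cmod z1"]]) (auto simp: S_def)
  ultimately have "compact S" by (simp add: compact_eq_bounded_closed)
  moreover have "z1 \<in> S" using z1 by (simp add: S_def)
  ultimately obtain z0 where z0: "z0 \<in> S" "\<And>z. z \<in> S \<Longrightarrow> cmod z0 \<le> cmod z"
    using continuous_attains_inf[of S cmod] by (auto intro: continuous_intros)
  have z0D: "z0 \<in> \<D>" using z0(1) sub by (auto simp: S_def)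
  have inside: "u z < c" if "z \<in> ball 0 (cmod z0)" for z
  proof (rule ccontr)
    assume "\<not> u z < c"
    hence "z \<in> S" using z0(1) that by (simp add: S_def)
    thus False using z0(2)[of z] that by simp
  qed
  have ge: "u z0 \<ge> c" using z0(1) by (simp add: S_def)
  have nz: "z0 \<noteq> 0" using ge u0 by auto
  have "isCont u z0"
    using cont z0D by (intro continuous_on_interior[of \<D>]) auto
  moreover have "((\<lambda>t. of_real t * z0) \<longlongrightarrow> of_real 1 * z0) (at_left (1::real))"
    by (intro tendsto_intros)
  ultimately have "((\<lambda>t. u (of_real t * z0)) \<longlongrightarrow> u z0) (at_left (1::real))"
    using isCont_tendsto_compose[of z0 u] by simp
  moreover have "eventually (\<lambda>t. u (of_real t * z0) \<le> c) (at_left (1::real))"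
    using eventually_at_left_real[of 0 "1::real"]
    by (auto elim!: eventually_mono intro!: less_imp_le inside simp: norm_mult nz)
  ultimately have "u z0 \<le> c" by (intro tendsto_upperbound) auto
  with ge z0D nz inside show ?thesis by (intro that[of z0]) auto
qed

text \<open>Let \<open>D = z0 * d / w z0\<close>.  Schwarz's lemma gives \<open>cmod (w (z0 * (1 + x * v))) \<le> cmod (1 + x * v)\<close> whenever
the point on the left is inside the circle through \<open>z0\<close>, with equality for \<open>x = 0\<close>.  Comparing the derivatives
at \<open>x = 0\<close> yields \<open>Re ((D - 1) * v) \<le> 0\<close> for all inward directions, that is, for \<open>Re v < 0\<close>.  This
forces \<open>D - 1\<close> to be real and nonnegative.\<close>

lemma jack_lemma:
  assumes z0: "z0 \<noteq> 0" and hol: "w holomorphic_on ball 0 (cmod z0)"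
    and bd: "\<And>z. z \<in> ball 0 (cmod z0) \<Longrightarrow> cmod (w z) < 1" and w0: "w 0 = 0"
    and contact: "cmod (w z0) = 1" and d: "(w has_field_derivative d) (at z0)"
  obtains k :: real where "k \<ge> 1" "z0 * d = of_real k * w z0"
proof -
  define r where "r = cmod z0"
  have r: "r > 0" using z0 by (simp add: r_def)
  have schwarz: "cmod (w z) \<le> cmod z / r" if "cmod z < r" for z
  proof -
    have "cmod (w (of_real r * (z / of_real r))) \<le> cmod (z / of_real r)"
    proof (rule Schwarz_Lemma(1)[where f = "\<lambda>z. w (of_real r * z)"])
      have "w \<circ> (\<lambda>z. of_real r * z) holomorphic_on \<D>"
        using r by (intro holomorphic_on_compose_gen[OF _ hol] holomorphic_intros)
                   (auto simp: norm_mult r_def[symmetric])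
      thus "(\<lambda>z. w (of_real r * z)) holomorphic_on \<D>" by (simp add: o_def)
    qed (use r w0 that bd in \<open>auto simp: norm_mult norm_divide r_def[symmetric]\<close>)
    thus ?thesis using r by (simp add: norm_divide)
  qed
  have wnz: "w z0 \<noteq> 0" using contact by auto
  define D where "D = z0 * d / w z0"
  have inward: "Re ((D - 1) * v) \<le> 0" if v: "Re v < 0" for v
  proof (rule ccontr)
    assume neg: "\<not> Re ((D - 1) * v) \<le> 0"
    define W where "W s = w (z0 * (1 + s * v))" for s
    have "(W has_field_derivative d * (z0 * v)) (at (of_real 0))"
      unfolding W_def
      by (rule DERIV_chain2[where f = w]) (use d in \<open>auto intro!: derivative_eq_intros\<close>)
    hence W: "((\<lambda>x::real. W (of_real x)) has_vector_derivative d * (z0 * v)) (at 0)"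
      by (rule has_vector_derivative_real_field)
    \<comment> \<open>\<open>\<phi> x\<close> is \<open>(cmod (W x))\<^sup>2 - (cmod (1 + x * v))\<^sup>2\<close>, written out so that it can be differentiated.\<close>
    define \<phi> where "\<phi> x = ((Re (W (of_real x)))\<^sup>2 + (Im (W (of_real x)))\<^sup>2)
                          - ((1 + x * Re v)\<^sup>2 + (x * Im v)\<^sup>2)" for x
    have "(\<phi> has_field_derivative (2 * Re (W 0) * Re (d * (z0 * v)) + 2 * Im (W 0) * Im (d * (z0 * v))
              - 2 * Re v)) (at 0)"
      unfolding \<phi>_def
      by (rule derivative_eq_intros has_field_derivative_Re[OF W] has_field_derivative_Im[OF W] refl)+
         (simp add: algebra_simps)
    moreover have "2 * Re (W 0) * Re (d * (z0 * v)) + 2 * Im (W 0) * Im (d * (z0 * v)) - 2 * Re v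
                    = 2 * Re ((D - 1) * v)"
    proof -
      have "Re (W 0) * Re (d * (z0 * v)) + Im (W 0) * Im (d * (z0 * v)) = Re (cnj (W 0) * (d * (z0 * v)))"
        by simp
      also have "cnj (W 0) * (d * (z0 * v)) = (w z0 * cnj (w z0)) * (D * v)"
        using wnz by (simp add: W_def D_def)
      also have "w z0 * cnj (w z0) = 1"
        using contact by (simp add: complex_norm_square[symmetric])
      finally show ?thesis by (simp add: algebra_simps)
    qed
    ultimately have "DERIV \<phi> 0 :> 2 * Re ((D - 1) * v)" by simp
    from DERIV_pos_inc_right[OF this] neg obtain e where
      e: "e > 0" "\<And>h. 0 < h \<Longrightarrow> h < e \<Longrightarrow> \<phi> 0 < \<phi> h" by auto
    have "((\<lambda>h. 2 * Re v + h * (cmod v)\<^sup>2) \<longlongrightarrow> 2 * Re v + 0 * (cmod v)\<^sup>2) (at_right 0)"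
      by (intro tendsto_intros)
    hence "eventually (\<lambda>h. 2 * Re v + h * (cmod v)\<^sup>2 < 0) (at_right 0)"
      by (rule order_tendstoD(2)) (use v in simp)
    moreover have "eventually (\<lambda>h. h \<in> {0<..<e}) (at_right 0)"
      using e(1) by (rule eventually_at_right_real)
    ultimately have "eventually (\<lambda>h. 2 * Re v + h * (cmod v)\<^sup>2 < 0 \<and> h \<in> {0<..<e}) (at_right 0)"
      by (rule eventually_conj)
    then obtain h where h: "2 * Re v + h * (cmod v)\<^sup>2 < 0" "0 < h" "h < e"
      using eventually_happens'[of "at_right (0::real)"] by fastforce
    have sq: "(cmod (1 + of_real h * v))\<^sup>2 = (1 + h * Re v)\<^sup>2 + (h * Im v)\<^sup>2"
      by (simp add: cmod_power2)
    have "(1 + h * Re v)\<^sup>2 + (h * Im v)\<^sup>2 = 1 + h * (2 * Re v + h * (cmod v)\<^sup>2)"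
      unfolding cmod_power2 by (simp add: power2_eq_square algebra_simps)
    also have "\<dots> < 1" using h by (simp add: mult_pos_neg)
    finally have "(cmod (1 + of_real h * v))\<^sup>2 < 1\<^sup>2" unfolding sq by simp
    hence lt: "cmod (1 + of_real h * v) < 1" by (rule power2_less_imp_less) simp
    have "cmod (W (of_real h)) \<le> cmod (z0 * (1 + of_real h * v)) / r"
      unfolding W_def using lt r by (intro schwarz) (simp add: norm_mult r_def[symmetric])
    also have "\<dots> = cmod (1 + of_real h * v)" using r by (simp add: norm_mult r_def[symmetric])
    finally have "(cmod (W (of_real h)))\<^sup>2 \<le> (cmod (1 + of_real h * v))\<^sup>2"
      by (rule power_mono) simp
    hence "\<phi> h \<le> 0" unfolding sq by (simp add: \<phi>_def cmod_power2)
    moreover have "\<phi> 0 = 0"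
      using contact cmod_power2[of "w z0"] by (simp add: \<phi>_def W_def)
    ultimately show False using e(2)[OF h(2,3)] by simp
  qed
  have Im0: "Im D = 0"
  proof (rule ccontr)
    assume ne: "Im D \<noteq> 0"
    \<comment> \<open>This direction is chosen such that \<open>Re ((D - 1) * v) = 1\<close>.\<close>
    show False using inward[of "Complex (-1) (- Re D / Im D)"] ne by simp
  qed
  have "Re D \<ge> 1" using inward[of "-1"] by simp
  moreover have "D = of_real (Re D)" using Im0 by (simp add: complex_eq_iff)
  hence "z0 * d = of_real (Re D) * w z0" using wnz by (metis D_def nonzero_eq_divide_eq)
  ultimately show ?thesis by (rule that)
qed

text \<open>In other words, \<open>1 / p\<close> is subordinate to \<open>1 / (1 - z)\<^sup>2\<close>.  Suppose that \<open>\<phi> = 1 - q\<close> reaches the unit circle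
for the first time at \<open>z0\<close>.  By Jack's lemma \<open>z0 * deriv \<phi> z0 = k * \<phi> z0\<close> with \<open>k \<ge> 1\<close>, and for
\<open>p = (1 - \<phi>)\<^sup>2\<close> the quantity in the hypothesis becomes \<open>\<phi> * ((2 * k - 2) - (2 * k - 1) * \<phi>)\<close> at \<open>z0\<close>, whose
modulus is at least \<open>(2 * k - 1) - (2 * k - 2) = 1\<close>.\<close>

lemma sqrt_in_disk:
  assumes hol: "p holomorphic_on \<D>" and nz: "\<And>z. z \<in> \<D> \<Longrightarrow> p z \<noteq> 0" and p0: "p 0 = 1"
    and cond: "\<And>z. z \<in> \<D> \<Longrightarrow> cmod (p z - z * deriv p z - 1) < 1"
  shows "\<exists>q. q holomorphic_on \<D> \<and> q 0 = 1 \<and> (\<forall>z\<in>\<D>. p z = (q z)\<^sup>2 \<and> cmod (1 - q z) < 1)"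
proof -
  have "contractible \<D>" by (intro convex_imp_contractible) auto
  then obtain q1 where q1: "q1 holomorphic_on \<D>" "\<And>z. z \<in> \<D> \<Longrightarrow> p z = (q1 z)\<^sup>2"
    using contractible_imp_holomorphic_sqrt[OF hol _ nz] by blast
  have q1sq: "(q1 0)\<^sup>2 = 1" using q1(2)[of 0] p0 by simp
  \<comment> \<open>\<open>q1 0\<close> is \<open>1\<close> or \<open>- 1\<close>; this picks the branch of the root with \<open>q 0 = 1\<close>.\<close>
  define q where "q z = q1 0 * q1 z" for z
  have q: "q holomorphic_on \<D>" unfolding q_def by (intro holomorphic_intros q1)
  have qp: "p z = (q z)\<^sup>2" if "z \<in> \<D>" for z
    using q1(2)[OF that] q1sq by (simp add: q_def power_mult_distrib)
  have q0: "q 0 = 1" using q1sq by (simp add: q_def power2_eq_square)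
  have "cmod (1 - q z1) < 1" if z1: "z1 \<in> \<D>" for z1
  proof (rule ccontr)
    assume "\<not> cmod (1 - q z1) < 1"
    moreover have "continuous_on \<D> (\<lambda>z. cmod (1 - q z))"
      by (intro continuous_intros holomorphic_on_imp_continuous_on[OF q])
    ultimately obtain z0 where z0: "z0 \<in> \<D>" "z0 \<noteq> 0" "cmod (1 - q z0) = 1"
        "\<And>z. z \<in> ball 0 (cmod z0) \<Longrightarrow> cmod (1 - q z) < 1"
      using first_contact[of "\<lambda>z. cmod (1 - q z)" 1 z1] z1 q0 by auto
    define \<phi> where "\<phi> = 1 - q z0"
    have dq: "(q has_field_derivative deriv q z0) (at z0)"
      using q z0(1) by (intro holomorphic_derivI[of _ \<D>]) auto
    obtain k :: real where k: "k \<ge> 1" "z0 * (- deriv q z0) = of_real k * (1 - q z0)"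
    proof (rule jack_lemma[OF z0(2), where w = "\<lambda>z. 1 - q z" and d = "- deriv q z0"])
      show "(\<lambda>z. 1 - q z) holomorphic_on ball 0 (cmod z0)"
        by (intro holomorphic_intros holomorphic_on_subset[OF q]) (use z0(1) in auto)
      show "((\<lambda>z. 1 - q z) has_field_derivative - deriv q z0) (at z0)"
        using dq by (auto intro!: derivative_eq_intros)
    qed (use z0 q0 in auto)
    have "(p has_field_derivative 2 * q z0 * deriv q z0) (at z0)"
    proof (rule has_field_derivative_transform_within_open[where S = "\<D>"])
      show "((\<lambda>z. (q z)\<^sup>2) has_field_derivative 2 * q z0 * deriv q z0) (at z0)"
        using dq by (auto intro!: derivative_eq_intros)
    qed (use z0(1) qp in auto)
    hence "deriv p z0 = 2 * q z0 * deriv q z0" by (rule DERIV_imp_deriv)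
    hence "p z0 - z0 * deriv p z0 - 1 = (q z0)\<^sup>2 + 2 * q z0 * (z0 * (- deriv q z0)) - 1"
      using qp[OF z0(1)] by simp
    also have "\<dots> = (1 - \<phi>)\<^sup>2 + 2 * (1 - \<phi>) * (of_real k * \<phi>) - 1"
      unfolding k(2) by (simp add: \<phi>_def)
    also have "\<dots> = \<phi> * (of_real (2 * k - 2) - of_real (2 * k - 1) * \<phi>)"
      by (simp add: power2_eq_square algebra_simps)
    finally have "cmod (p z0 - z0 * deriv p z0 - 1) =
        cmod (of_real (2 * k - 2) - of_real (2 * k - 1) * \<phi>)"
      using z0(3) by (simp add: norm_mult \<phi>_def)
    moreover have "cmod (of_real (2 * k - 1) * \<phi>) - cmod (of_real (2 * k - 2)) \<le>
        cmod (of_real (2 * k - 2) - of_real (2 * k - 1) * \<phi>)"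
      by (metis norm_minus_commute norm_triangle_ineq2)
    moreover have "cmod (of_real (2 * k - 1) * \<phi>) = 2 * k - 1"
      unfolding norm_mult norm_of_real using k(1) z0(3) by (simp add: \<phi>_def)
    moreover have "cmod (of_real (2 * k - 2)) = 2 * k - 2"
      unfolding norm_of_real using k(1) by simp
    ultimately show False using cond[OF z0(1)] by linarith
  qed
  with q q0 qp show ?thesis by blast
qed

text \<open>The function \<open>h\<close> is the mean \<open>(1 / z) * \<integral> 1 / q\<^sup>2\<close> over the segment from \<open>0\<close> to \<open>z\<close>.  Suppose that it
reaches the line \<open>Re h = 1 / 2\<close> for the first time at \<open>z0\<close>, where \<open>h = 1 / 2 + \<i> * y\<close>.  Jack's lemma for
\<open>(h - 1) / h\<close> says \<open>z0 * deriv h z0 = k * h * (h - 1) = - k * (1 / 4 + y\<^sup>2)\<close> with \<open>k \<ge> 1\<close>.  Hence \<open>1 / q\<^sup>2\<close> has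
imaginary part \<open>y\<close> and real part at most \<open>1 / 4 - y\<^sup>2\<close> there.  But \<open>1 / q\<close> lies in the half-plane
\<open>Re > 1 / 2\<close>, which squaring maps to the region \<open>Re > 1 / 4 - Im\<^sup>2\<close> outside a parabola.

This replaces the integral representation of functions subordinate to \<open>1 / (1 - z)\<^sup>2\<close>: such a
function is an average of the functions \<open>1 / (1 - x * z)\<^sup>2\<close> with \<open>cmod x = 1\<close>, whose means
\<open>1 / (1 - x * z)\<close> lie in the half-plane.\<close>

lemma average_in_half_plane:
  assumes q: "q holomorphic_on \<D>" and q0: "q 0 = 1"
    and disk: "\<And>z. z \<in> \<D> \<Longrightarrow> cmod (1 - q z) < 1"
  shows "\<exists>h. h holomorphic_on \<D> \<and> h 0 = 1 \<and>
             (\<forall>z\<in>\<D>. Re (h z) > 1 / 2 \<and> h z + z * deriv h z = 1 / (q z)\<^sup>2)"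
proof -
  have qnz: "q z \<noteq> 0" if "z \<in> \<D>" for z using disk[OF that] by auto
  have "(\<lambda>z. 1 / (q z)\<^sup>2) holomorphic_on \<D>"
    by (intro holomorphic_intros q) (use qnz in auto)
  then obtain F1 where F1: "\<And>z. z \<in> \<D> \<Longrightarrow> (F1 has_field_derivative 1 / (q z)\<^sup>2) (at z within \<D>)"
    using holomorphic_convex_primitive'[of \<D>] by auto
  define F where "F z = F1 z - F1 0" for z
  have F: "(F has_field_derivative 1 / (q z)\<^sup>2) (at z)" if "z \<in> \<D>" for z
    using F1[OF that] that unfolding F_def
    by (auto intro!: derivative_eq_intros simp: at_within_open[of z \<D>])
  have "F holomorphic_on \<D>" using F unfolding holomorphic_on_open[OF open_ball] by blast
  then obtain h where h: "h holomorphic_on \<D>" "\<And>z. cmod z < 1 \<Longrightarrow> F z = z * h z" "deriv F 0 = h 0"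
    using Schwarz3[of F 1] by (auto simp: F_def)
  have h0: "h 0 = 1" using h(3) DERIV_imp_deriv[OF F[of 0]] q0 by simp
  have dh: "(h has_field_derivative deriv h z) (at z)" if "z \<in> \<D>" for z
    using h(1) that by (intro holomorphic_derivI[of _ \<D>]) auto
  have ode: "h z + z * deriv h z = 1 / (q z)\<^sup>2" if z: "z \<in> \<D>" for z
  proof -
    have "(F has_field_derivative h z + z * deriv h z) (at z)"
    proof (rule has_field_derivative_transform_within_open[where S = "\<D>"])
      show "((\<lambda>z. z * h z) has_field_derivative h z + z * deriv h z) (at z)"
        using dh[OF z] by (auto intro!: derivative_eq_intros)
    qed (use z h(2) in auto)
    thus ?thesis using F[OF z] by (rule DERIV_unique)
  qed
  have "Re (h z1) > 1 / 2" if z1: "z1 \<in> \<D>" for z1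
  proof (rule ccontr)
    assume "\<not> Re (h z1) > 1 / 2"
    moreover have "continuous_on \<D> (\<lambda>z. - Re (h z))"
      by (intro continuous_intros holomorphic_on_imp_continuous_on[OF h(1)])
    ultimately obtain z0 where z0: "z0 \<in> \<D>" "z0 \<noteq> 0" "Re (h z0) = 1 / 2"
        "\<And>z. z \<in> ball 0 (cmod z0) \<Longrightarrow> Re (h z) > 1 / 2"
      using first_contact[of "\<lambda>z. - Re (h z)" "- 1 / 2" z1] z1 h0 by auto
    have hz0: "h z0 \<noteq> 0" using z0(3) by auto
    have hball: "h z \<noteq> 0" if "z \<in> ball 0 (cmod z0)" for z using z0(4)[OF that] by auto
    have norm_diff: "(cmod (h z))\<^sup>2 - (cmod (h z - 1))\<^sup>2 = 2 * Re (h z) - 1" for z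
      unfolding cmod_power2 by (simp add: power2_eq_square algebra_simps)
    obtain k :: real where k: "k \<ge> 1"
      "z0 * (deriv h z0 / (h z0)\<^sup>2) = of_real k * ((h z0 - 1) / h z0)"
    proof (rule jack_lemma[OF z0(2), where w = "\<lambda>z. (h z - 1) / h z" and d = "deriv h z0 / (h z0)\<^sup>2"])
      show "(\<lambda>z. (h z - 1) / h z) holomorphic_on ball 0 (cmod z0)"
        by (intro holomorphic_intros holomorphic_on_subset[OF h(1)]) (use z0(1) hball in auto)
      show "((\<lambda>z. (h z - 1) / h z) has_field_derivative deriv h z0 / (h z0)\<^sup>2) (at z0)"
        using dh[OF z0(1)] hz0
        by (auto intro!: derivative_eq_intros simp: power2_eq_square divide_simps algebra_simps)
      have "(cmod (h z0))\<^sup>2 = (cmod (h z0 - 1))\<^sup>2" using norm_diff[of z0] z0(3) by simp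
      hence "cmod (h z0) = cmod (h z0 - 1)" by (simp add: power2_eq_iff_nonneg)
      thus "cmod ((h z0 - 1) / h z0) = 1"
        unfolding norm_divide using hz0 by (metis divide_self norm_eq_zero)
      show "cmod ((h z - 1) / h z) < 1" if z: "z \<in> ball 0 (cmod z0)" for z
      proof -
        have "(cmod (h z - 1))\<^sup>2 < (cmod (h z))\<^sup>2" using norm_diff[of z] z0(4)[OF z] by simp
        hence "cmod (h z - 1) < cmod (h z)" by (rule power2_less_imp_less) simp
        thus ?thesis using hball[OF z] by (simp add: norm_divide)
      qed
    qed (use h0 in auto)
    define y where "y = Im (h z0)"
    have hy: "h z0 = Complex (1 / 2) y" using z0(3) by (simp add: complex_eq_iff y_def)
    have "z0 * deriv h z0 = (z0 * (deriv h z0 / (h z0)\<^sup>2)) * (h z0)\<^sup>2" using hz0 by simp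
    also have "\<dots> = of_real k * (h z0 * (h z0 - 1))"
      unfolding k(2) using hz0 by (simp add: power2_eq_square)
    finally have eq: "1 / (q z0)\<^sup>2 = h z0 + of_real k * (h z0 * (h z0 - 1))"
      using ode[OF z0(1)] by simp
    define a where "a = Re (1 / q z0)"
    define b where "b = Im (1 / q z0)"
    have v: "1 / q z0 = Complex a b" by (simp add: a_def b_def)
    have "Complex a b ^ 2 = h z0 + of_real k * (h z0 * (h z0 - 1))"
      using eq unfolding v[symmetric] by (simp add: power_divide)
    hence re: "a\<^sup>2 - b\<^sup>2 = 1 / 2 - k * (1 / 4 + y\<^sup>2)" and im: "2 * a * b = y"
      unfolding hy by (auto simp: complex_eq_iff power2_eq_square algebra_simps)
    have a: "a > 1 / 2"
    proof -
      define s where "s = Re (q z0)"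
      define t where "t = Im (q z0)"
      define N where "N = s\<^sup>2 + t\<^sup>2"
      have "(cmod (1 - q z0))\<^sup>2 < 1" using disk[OF z0(1)] by (simp add: abs_square_less_1)
      hence "N < 2 * s"
        unfolding cmod_power2 by (simp add: N_def s_def t_def power2_eq_square algebra_simps)
      moreover have "N > 0"
        using qnz[OF z0(1)] by (auto simp: N_def s_def t_def complex_eq_iff sum_power2_gt_zero_iff)
      ultimately have "1 / 2 < s / N" by (simp add: less_divide_eq)
      also have "s / N = a" by (simp add: N_def a_def s_def t_def Re_divide)
      finally show ?thesis .
    qed
    have "1 / 4 < a\<^sup>2" using a power_strict_mono[of "1/2" a 2] by (simp add: power2_eq_square)
    moreover have "b\<^sup>2 \<le> y\<^sup>2"
    proof -
      have "1 * b\<^sup>2 \<le> 4 * a\<^sup>2 * b\<^sup>2" using \<open>1 / 4 < a\<^sup>2\<close> by (intro mult_right_mono) auto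
      thus ?thesis unfolding im[symmetric] by (simp add: power_mult_distrib)
    qed
    moreover have "1 * (1 / 4 + y\<^sup>2) \<le> k * (1 / 4 + y\<^sup>2)" using k(1) by (intro mult_right_mono) auto
    hence "a\<^sup>2 - b\<^sup>2 \<le> 1 / 4 - y\<^sup>2" unfolding re by simp
    ultimately show False by linarith
  qed
  with h(1) h0 ode show ?thesis by blast
qed

section \<open>Coefficient inequalities for functions of the class\<close>

text \<open>Differentiating \<open>f z * p z = z\<close> and multiplying by \<open>p z\<close> gives \<open>deriv f z * (p z)\<^sup>2 = p z - z * deriv p z\<close>,
so that the defining inequality of the class becomes linear in \<open>p\<close>.\<close>

lemma z_over_class_U:
  assumes f: "f \<in> class_U"
  defines "p \<equiv> z_over f"
  shows "p holomorphic_on \<D>" and "p 0 = 1" and "\<And>z. z \<in> \<D> \<Longrightarrow> p z \<noteq> 0"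
    and "\<And>z. z \<in> \<D> \<Longrightarrow> f z * p z = z"
    and "\<And>z. z \<in> \<D> \<Longrightarrow> cmod (p z - z * deriv p z - 1) < 1"
proof -
  have holf: "f holomorphic_on \<D>" and f0: "f 0 = 0" and df0: "deriv f 0 = 1"
    and fnz: "\<And>z. z \<in> \<D> - {0} \<Longrightarrow> f z \<noteq> 0"
    and cond: "\<And>z. z \<in> \<D> \<Longrightarrow> cmod (deriv f z * (p z)\<^sup>2 - 1) < 1"
    using f by (auto simp: class_U_def class_A_def analytic_imp_holomorphic p_def)
  obtain g where g: "g holomorphic_on \<D>" "\<And>z. cmod z < 1 \<Longrightarrow> f z = z * g z" "deriv f 0 = g 0"
    using Schwarz3[OF holf f0] by metis
  have gnz: "g z \<noteq> 0" if "z \<in> \<D>" for z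
    using fnz[of z] g(2)[of z] g(3) df0 that by (cases "z = 0") auto
  have p_eq: "p z = 1 / g z" if "z \<in> \<D>" for z
    using g(2)[of z] g(3) df0 that by (auto simp: p_def z_over_def)
  have "(\<lambda>z. 1 / g z) holomorphic_on \<D>"
    by (intro holomorphic_intros g) (use gnz in auto)
  thus hol: "p holomorphic_on \<D>"
    by (rule holomorphic_transform) (simp add: p_eq)
  show "p 0 = 1" by (simp add: p_def z_over_def)
  show "p z \<noteq> 0" if "z \<in> \<D>" for z using p_eq[OF that] gnz[OF that] by simp
  show fp: "f z * p z = z" if "z \<in> \<D>" for z
    using p_eq[OF that] gnz[OF that] g(2)[of z] that by simp
  show "cmod (p z - z * deriv p z - 1) < 1" if z: "z \<in> \<D>" for z
  proof -
    have "(f has_field_derivative deriv f z) (at z)" "(p has_field_derivative deriv p z) (at z)"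
      using holf hol z by (auto intro!: holomorphic_derivI[of _ \<D>])
    hence "((\<lambda>z. f z * p z) has_field_derivative deriv f z * p z + deriv p z * f z) (at z)"
      by (rule DERIV_mult)
    hence "((\<lambda>z. z) has_field_derivative deriv f z * p z + deriv p z * f z) (at z)"
      by (rule has_field_derivative_transform_within_open[where S = \<D>]) (use z fp in auto)
    hence "deriv f z * p z + deriv p z * f z = 1" using DERIV_ident DERIV_unique by blast
    hence "deriv f z * (p z)\<^sup>2 = p z - (f z * p z) * deriv p z" by algebra
    thus ?thesis using cond[OF z] fp[OF z] by simp
  qed
qed

lemma has_expansion_fps:
  assumes "has_expansion f a"
  shows "f has_fps_expansion Abs_fps (\<lambda>n. if n = 0 then 0 else if n = 1 then 1 else a n)"
proof (rule has_fps_expansionI)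
  define c where "c n = (if n = 0 then 0 else if n = 1 then 1 else a n)" for n
  have "(\<lambda>n. c n * z ^ n) sums f z" if "z \<in> \<D>" for z
  proof -
    have "(\<lambda>n. c (n + 2) * z ^ (n + 2)) sums (f z - z)"
      using assms that by (simp add: has_expansion_def c_def)
    hence "(\<lambda>n. c n * z ^ n) sums (f z - z + (\<Sum>i<2. c i * z ^ i))"
      by (subst (asm) sums_iff_shift)
    thus ?thesis by (simp add: c_def numeral_2_eq_2)
  qed
  moreover have "eventually (\<lambda>z. z \<in> \<D>) (nhds (0::complex))"
    by (intro eventually_nhds_in_open) auto
  ultimately show "eventually (\<lambda>z. (\<lambda>n. Abs_fps (\<lambda>n. if n = 0 then 0 else if n = 1 then 1 else a n) $ n
      * z ^ n) sums f z) (nhds 0)"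
    by (auto elim!: eventually_mono simp: c_def)
qed

text \<open>The coefficient of \<open>z ^ n\<close> in \<open>p z - z * deriv p z - 1\<close> is \<open>(1 - n) * B $ n\<close> for \<open>n \<ge> 1\<close>, so this function is
\<open>z\<^sup>2\<close> times a bounded one, with coefficients \<open>- B $ 2\<close>, \<open>- 2 * B $ 3\<close> and \<open>- 3 * B $ 4\<close>.\<close>

lemma reciprocal_coeff_bounds:
  assumes hol: "p holomorphic_on \<D>" and p0: "p 0 = 1"
    and cond: "\<And>z. z \<in> \<D> \<Longrightarrow> cmod (p z - z * deriv p z - 1) < 1"
    and B: "p has_fps_expansion B"
  shows "cmod (B $ 2) \<le> 1" "2 * cmod (B $ 3) \<le> 1 - (cmod (B $ 2))\<^sup>2"
    "3 * cmod (B $ 4) \<le> 1 - (cmod (B $ 2))\<^sup>2"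
proof -
  define u where "u z = p z - z * deriv p z - 1" for z
  have holu: "u holomorphic_on \<D>" unfolding u_def by (intro holomorphic_intros hol) auto
  have U: "u has_fps_expansion B - fps_X * fps_deriv B - 1"
    unfolding u_def by (intro fps_expansion_intros B)
  have B0: "B $ 0 = 1" using has_fps_expansion_imp_0_eq_fps_nth_0[OF B] p0 by simp
  have "(B - fps_X * fps_deriv B - 1) $ k = 0" if "k < 2" for k
    using that B0 by (auto simp: less_2_cases_iff)
  then obtain g where g: "g holomorphic_on \<D>" "\<And>z. z \<in> \<D> \<Longrightarrow> cmod (g z) \<le> 1"
      "\<And>z. z \<in> \<D> \<Longrightarrow> u z = z ^ 2 * g z"
    using factor_power_of_bounded[OF holu _ U, of 2] cond by (force simp: u_def)
  define G where "G = fps_expansion g 0"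
  have G: "g has_fps_expansion G" unfolding G_def by (rule disk_expansion[OF g(1)])
  have eq: "B - fps_X * fps_deriv B - 1 = fps_X ^ 2 * G"
    by (rule disk_expansion_unique[OF U _ g(3)]) (intro fps_expansion_intros G, auto)
  have nth: "G $ k = - of_nat (k + 1) * B $ (k + 2)" for k
  proof -
    have "G $ k = (B - fps_X * fps_deriv B - 1) $ (k + 2)"
      unfolding eq by (simp add: fps_X_power_mult_nth)
    thus ?thesis by (simp add: algebra_simps)
  qed
  have G2: "G $ 0 = - B $ 2" "G $ 1 = - 2 * B $ 3" "G $ 2 = - 3 * B $ 4"
    using nth[of 0] nth[of 1] nth[of 2] by (simp_all add: numeral_eq_Suc)
  show "cmod (B $ 2) \<le> 1" using bounded_coeff_le_1[OF g(1,2) G, of 0] by (simp add: G2)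
  show "2 * cmod (B $ 3) \<le> 1 - (cmod (B $ 2))\<^sup>2" "3 * cmod (B $ 4) \<le> 1 - (cmod (B $ 2))\<^sup>2"
    using schwarz_pick_coeff[OF g(1,2) G, of 1] schwarz_pick_coeff[OF g(1,2) G, of 2]
    by (simp_all add: G2 norm_mult del: One_nat_def)
qed

text \<open>Here \<open>q z = 1 - z * g z\<close> with \<open>g\<close> bounded, so \<open>B $ 1 = - 2 * G $ 0\<close> and \<open>B $ 2 = (G $ 0)\<^sup>2 - 2 * G $ 1\<close>, and
\<open>G $ 1\<close> is controlled by \<open>G $ 0\<close>.  The result says that the modulus of \<open>B $ 2\<close> cannot
be much smaller than \<open>1\<close> if that of \<open>B $ 1\<close> is close to its largest possible value \<open>2\<close>.\<close>

lemma square_coeff_bound: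
  assumes q: "q holomorphic_on \<D>" "q 0 = 1" "\<And>z. z \<in> \<D> \<Longrightarrow> cmod (1 - q z) < 1"
    and pq: "\<And>z. z \<in> \<D> \<Longrightarrow> p z = (q z)\<^sup>2" and B: "p has_fps_expansion B"
  shows "3 * ((cmod (B $ 1))\<^sup>2 / 4) \<le> 2 + cmod (B $ 2)"
proof -
  define u where "u z = 1 - q z" for z
  have holu: "u holomorphic_on \<D>" unfolding u_def by (intro holomorphic_intros q)
  have "fps_expansion u 0 $ 0 = 0"
    using has_fps_expansion_imp_0_eq_fps_nth_0[OF disk_expansion[OF holu]] q(2)
    by (simp add: u_def)
  then obtain g where g: "g holomorphic_on \<D>" "\<And>z. z \<in> \<D> \<Longrightarrow> cmod (g z) \<le> 1"
      "\<And>z. z \<in> \<D> \<Longrightarrow> u z = z * g z"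
    using factor_power_of_bounded[OF holu _ disk_expansion[OF holu], of 1] q(3)
    by (force simp: u_def less_imp_le)
  define G where "G = fps_expansion g 0"
  have G: "g has_fps_expansion G" unfolding G_def by (rule disk_expansion[OF g(1)])
  have "B = (1 - fps_X * G) ^ 2"
  proof (rule disk_expansion_unique[OF B])
    show "(\<lambda>z. (1 - z * g z) ^ 2) has_fps_expansion (1 - fps_X * G) ^ 2"
      by (intro fps_expansion_intros G)
    show "p z = (1 - z * g z) ^ 2" if "z \<in> \<D>" for z
    proof -
      have "1 - z * g z = q z" unfolding g(3)[OF that, symmetric] by (simp add: u_def)
      thus ?thesis using pq[OF that] by simp
    qed
  qed
  hence B_eq: "B = 1 - fps_X * (fps_const 2 * G) + fps_X * (fps_X * (G * G))"
    by (simp add: power2_eq_square algebra_simps numeral_fps_const[symmetric])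
  have B1: "B $ 1 = - 2 * G $ 0" and B2: "B $ 2 = (G $ 0)\<^sup>2 - 2 * G $ 1"
    unfolding B_eq by (simp_all add: numeral_2_eq_2 fps_mult_nth power2_eq_square)
  have "cmod (G $ 1) \<le> 1 - (cmod (G $ 0))\<^sup>2"
    using schwarz_pick_coeff[OF g(1,2) G, of 1] by simp
  moreover have "cmod ((G $ 0)\<^sup>2) \<le> cmod (B $ 2) + cmod (2 * G $ 1)"
    unfolding B2 by (rule order_trans[OF _ norm_triangle_ineq]) simp
  ultimately show ?thesis
    unfolding B1 by (simp add: norm_mult norm_power power_mult_distrib)
qed

text \<open>The left side is affine and increasing in \<open>T\<close>, and for the largest admissible value \<open>T = (2 + x) / 3\<close>
the difference of the two sides is \<open>(1 - x) * (2 - x - x\<^sup>2 / 3)\<close>.\<close>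

lemma zalcman_3_real:
  fixes T x :: real
  assumes "0 \<le> x" "x \<le> 1" "3 * T \<le> 2 + x"
  shows "4 * T * x + (4 / 3 + T) * (1 - x\<^sup>2) \<le> 4"
proof -
  have "x\<^sup>2 \<le> 1" using assms by (simp add: power_le_one)
  have "3 * T * (4 * x + 1 - x\<^sup>2) \<le> (2 + x) * (4 * x + 1 - x\<^sup>2)"
    using assms \<open>x\<^sup>2 \<le> 1\<close> by (intro mult_right_mono) auto
  moreover have "(1 - x) * (2 - x - x\<^sup>2 / 3) \<ge> 0"
    using assms \<open>x\<^sup>2 \<le> 1\<close> by (intro mult_nonneg_nonneg) auto
  moreover have "3 * (4 - (4 * T * x + (4 / 3 + T) * (1 - x\<^sup>2))) =
      (2 + x) * (4 * x + 1 - x\<^sup>2) - 3 * T * (4 * x + 1 - x\<^sup>2)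
      + 3 * ((1 - x) * (2 - x - x\<^sup>2 / 3))"
    by (simp add: field_simps power2_eq_square)
  moreover have "0 \<le> u" if "3 * u = v - w + 3 * y" "w \<le> v" "0 \<le> y" for u v w y :: real
    using that by linarith
  ultimately have "0 \<le> 4 - (4 * T * x + (4 / 3 + T) * (1 - x\<^sup>2))" by blast
  thus ?thesis by simp
qed

text \<open>The triangle inequality with \<open>x = cmod b2\<close>, \<open>T = (cmod b1)\<^sup>2 / 4\<close> and the estimate \<open>cmod b1 \<le> 1 + T\<close>.
The bounds on \<open>b2\<close>, \<open>b3\<close> and \<open>b4\<close> together with \<open>cmod b1 \<le> 2\<close> would not suffice here: they admit
values of the upper estimate above \<open>4\<close> when \<open>x\<close> is slightly below \<open>1\<close> and \<open>T = 1\<close>.\<close>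

lemma zalcman_3:
  fixes b1 b2 b3 b4 :: complex
  assumes "cmod b2 \<le> 1" "2 * cmod b3 \<le> 1 - (cmod b2)\<^sup>2" "3 * cmod b4 \<le> 1 - (cmod b2)\<^sup>2"
    and T: "3 * ((cmod b1)\<^sup>2 / 4) \<le> 2 + cmod b2"
  shows "cmod (b1\<^sup>2 * b2 - 2 * b1 * b3 + b4) \<le> 4"
proof -
  define x where "x = cmod b2"
  define T where "T = (cmod b1)\<^sup>2 / 4"
  have x2: "0 \<le> 1 - x\<^sup>2" using assms(1) by (simp add: x_def power_le_one)
  have "cmod (b1\<^sup>2 * b2 - 2 * b1 * b3 + b4) \<le> cmod (b1\<^sup>2 * b2) + cmod (2 * b1 * b3) + cmod b4"
    by (meson norm_triangle_ineq norm_triangle_ineq4 add_right_mono order_trans)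
  also have "cmod (b1\<^sup>2 * b2) = 4 * T * x"
    by (simp add: norm_mult norm_power T_def x_def)
  also have "cmod (2 * b1 * b3) = cmod b1 * (2 * cmod b3)" by (simp add: norm_mult)
  also have "\<dots> \<le> cmod b1 * (1 - x\<^sup>2)"
    using assms(2) by (intro mult_left_mono) (auto simp: x_def)
  also have "cmod b1 * (1 - x\<^sup>2) \<le> (1 + T) * (1 - x\<^sup>2)"
  proof (rule mult_right_mono[OF _ x2])
    have "0 \<le> (cmod b1 / 2 - 1)\<^sup>2" by simp
    thus "cmod b1 \<le> 1 + T" by (simp add: T_def power2_eq_square algebra_simps)
  qed
  also have "cmod b4 \<le> (1 - x\<^sup>2) / 3" using assms(3) by (simp add: x_def)
  also have "4 * T * x + (1 + T) * (1 - x\<^sup>2) + (1 - x\<^sup>2) / 3 = 4 * T * x + (4 / 3 + T) * (1 - x\<^sup>2)"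
    by (simp add: field_simps)
  also have "\<dots> \<le> 4"
    by (rule zalcman_3_real) (use assms in \<open>auto simp: x_def T_def\<close>)
  finally show ?thesis by simp
qed

lemma inverse_coeffs:
  fixes A B :: "complex fps"
  assumes "A * B = 1" "B $ 0 = 1"
  shows "(A $ 1)\<^sup>2 - A $ 2 = B $ 2"
    and "(A $ 2)\<^sup>2 - A $ 4 = (B $ 1)\<^sup>2 * B $ 2 - 2 * B $ 1 * B $ 3 + B $ 4"
proof -
  define a1 a2 a3 a4 where "a1 = A $ 1" and "a2 = A $ 2" and "a3 = A $ 3" and "a4 = A $ 4"
  define b1 b2 b3 b4 where "b1 = B $ 1" and "b2 = B $ 2" and "b3 = B $ 3" and "b4 = B $ 4"
  note defs = a1_def a2_def a3_def a4_def b1_def b2_def b3_def b4_def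
  have nth: "(A * B) $ n = (if n = 0 then 1 else 0)" for n using assms(1) by simp
  have A0: "A $ 0 = 1" using nth[of 0] assms(2) by simp
  have "b1 + a1 = 0" "b2 + a1 * b1 + a2 = 0" "b3 + a1 * b2 + a2 * b1 + a3 = 0"
    "b4 + a1 * b3 + a2 * b2 + a3 * b1 + a4 = 0"
    using nth[of 1] nth[of 2] nth[of 3] nth[of 4] assms(2) A0
    by (simp_all add: defs fps_mult_nth eval_nat_numeral add_ac)
  hence "a1\<^sup>2 - a2 = b2" "a2\<^sup>2 - a4 = b1\<^sup>2 * b2 - 2 * b1 * b3 + b4"
    by algebra+
  thus "(A $ 1)\<^sup>2 - A $ 2 = B $ 2"
    "(A $ 2)\<^sup>2 - A $ 4 = (B $ 1)\<^sup>2 * B $ 2 - 2 * B $ 1 * B $ 3 + B $ 4"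
    unfolding defs .
qed

text \<open>The expression equals \<open>(n - 1)\<^sup>2 * s\<^sup>2 - (2 * n - 1) * (t - s\<^sup>2)\<close>.  By the hypothesis its modulus is at most a
convex combination of \<open>(n - 1)\<^sup>2\<close> and \<open>2 * n - 1\<close>, and the former is the larger one for \<open>n \<ge> 4\<close>.\<close>

lemma zalcman_large:
  fixes s t :: complex
  assumes n: "n \<ge> 4" and st: "cmod (t - s\<^sup>2) \<le> 1 - (cmod s)\<^sup>2"
  shows "cmod ((of_nat n * s)\<^sup>2 - of_nat (2 * n - 1) * t) \<le> (real n - 1)\<^sup>2"
proof -
  have eq: "(of_nat n * s)\<^sup>2 - of_nat (2 * n - 1) * t =
      of_real ((real n - 1)\<^sup>2) * s\<^sup>2 - of_real (2 * real n - 1) * (t - s\<^sup>2)"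
    using n by (simp add: of_nat_diff power2_eq_square algebra_simps)
  have "cmod ((of_nat n * s)\<^sup>2 - of_nat (2 * n - 1) * t) \<le>
      cmod (of_real ((real n - 1)\<^sup>2) * s\<^sup>2) + cmod (of_real (2 * real n - 1) * (t - s\<^sup>2))"
    unfolding eq by (rule norm_triangle_ineq4)
  also have "cmod (of_real ((real n - 1)\<^sup>2) * s\<^sup>2) = (real n - 1)\<^sup>2 * (cmod s)\<^sup>2"
    unfolding norm_mult norm_of_real by (simp add: norm_power)
  also have "cmod (of_real (2 * real n - 1) * (t - s\<^sup>2)) = (2 * real n - 1) * cmod (t - s\<^sup>2)"
    unfolding norm_mult norm_of_real using n by simp
  also have "(2 * real n - 1) * cmod (t - s\<^sup>2) \<le> (real n - 1)\<^sup>2 * (1 - (cmod s)\<^sup>2)"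
  proof (rule mult_mono)
    have "4 * real n \<le> real n * real n" using n by (intro mult_right_mono) auto
    thus "2 * real n - 1 \<le> (real n - 1)\<^sup>2" by (simp add: power2_eq_square algebra_simps)
  qed (use st in auto)
  also have "(real n - 1)\<^sup>2 * (cmod s)\<^sup>2 + (real n - 1)\<^sup>2 * (1 - (cmod s)\<^sup>2) = (real n - 1)\<^sup>2"
    by (simp add: algebra_simps)
  finally show ?thesis by simp
qed

lemma class_U_zalcman:
  assumes f: "f \<in> class_U" and a: "has_expansion f a" and n: "n \<ge> 2"
  shows "cmod ((a n)\<^sup>2 - a (2 * n - 1)) \<le> (real n - 1)\<^sup>2"
proof -
  define p where "p = z_over f"
  note p = z_over_class_U[OF f, folded p_def]
  define B where "B = fps_expansion p 0"
  have B: "p has_fps_expansion B" unfolding B_def by (rule disk_expansion[OF p(1)])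
  have B0: "B $ 0 = 1" using has_fps_expansion_imp_0_eq_fps_nth_0[OF B] p(2) by simp
  define A where "A = inverse B"
  have A: "(\<lambda>z. inverse (p z)) has_fps_expansion A"
    unfolding A_def by (intro fps_expansion_intros B) (simp add: B0)
  have AB: "A * B = 1" unfolding A_def using B0 by (simp add: inverse_mult_eq_1)
  have "Abs_fps (\<lambda>n. if n = 0 then 0 else if n = 1 then 1 else a n) = fps_X * A"
  proof (rule disk_expansion_unique[OF has_expansion_fps[OF a]])
    show "(\<lambda>z. z * inverse (p z)) has_fps_expansion fps_X * A"
      by (intro fps_expansion_intros A)
    show "f z = z * inverse (p z)" if "z \<in> \<D>" for z
      using p(4)[OF that] p(3)[OF that] by (simp add: field_simps)
  qed
  hence a_eq: "a n = A $ (n - 1)" if "n \<ge> 2" for n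
    using that by (auto simp: fps_eq_iff dest!: spec[of _ n])
  obtain q where q: "q holomorphic_on \<D>" "q 0 = 1" "\<And>z. z \<in> \<D> \<Longrightarrow> p z = (q z)\<^sup>2"
      "\<And>z. z \<in> \<D> \<Longrightarrow> cmod (1 - q z) < 1"
    using sqrt_in_disk[OF p(1,3,2,5)] by blast
  consider "n = 2" | "n = 3" | "n \<ge> 4" using n by linarith
  thus ?thesis
  proof cases
    case 1
    thus ?thesis
      using inverse_coeffs(1)[OF AB B0] reciprocal_coeff_bounds(1)[OF p(1,2,5) B] by (simp add: a_eq)
  next
    case 2
    have "cmod ((A $ 2)\<^sup>2 - A $ 4) \<le> 4"
      unfolding inverse_coeffs(2)[OF AB B0]
      by (intro zalcman_3 reciprocal_coeff_bounds[OF p(1,2,5) B] square_coeff_bound[OF q(1,2,4,3) B])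
    thus ?thesis using 2 by (simp add: a_eq)
  next
    case 3
    obtain h where h: "h holomorphic_on \<D>" "h 0 = 1" "\<And>z. z \<in> \<D> \<Longrightarrow> Re (h z) > 1 / 2"
        "\<And>z. z \<in> \<D> \<Longrightarrow> h z + z * deriv h z = 1 / (q z)\<^sup>2"
      using average_in_half_plane[OF q(1,2,4)] by blast
    define H where "H = fps_expansion h 0"
    have H: "h has_fps_expansion H" unfolding H_def by (rule disk_expansion[OF h(1)])
    have H0: "H $ 0 = 1" using has_fps_expansion_imp_0_eq_fps_nth_0[OF H] h(2) by simp
    have "A = H + fps_X * fps_deriv H"
    proof (rule disk_expansion_unique[OF A])
      show "(\<lambda>z. h z + z * deriv h z) has_fps_expansion H + fps_X * fps_deriv H"
        by (intro fps_expansion_intros H)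
      show "inverse (p z) = h z + z * deriv h z" if "z \<in> \<D>" for z
        using h(4)[OF that] q(3)[OF that] by (simp add: inverse_eq_divide)
    qed
    hence A_nth: "A $ k = of_nat (k + 1) * H $ k" for k
      by (cases k) (simp_all add: algebra_simps)
    have "a n = of_nat n * H $ (n - 1)" using 3 by (simp add: a_eq A_nth)
    moreover have "a (2 * n - 1) = of_nat (2 * n - 1) * H $ (2 * (n - 1))"
      using 3 by (simp add: a_eq A_nth of_nat_diff diff_mult_distrib2 numeral_eq_Suc)
    moreover have "cmod (H $ (2 * (n - 1)) - (H $ (n - 1))\<^sup>2) \<le> 1 - (cmod (H $ (n - 1)))\<^sup>2"
      using 3 h(3) by (intro livingston_inequality[OF h(1) _ H H0]) (auto intro: less_imp_le)
    ultimately show ?thesis using zalcman_large[OF 3] by simp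
  qed
qed

section \<open>The Koebe function and its rotations\<close>

text \<open>For these functions \<open>z / f z = (1 - x * z)\<^sup>2\<close>, and the quantity in the definition of the class
is \<open>- (x * z)\<^sup>2\<close>.\<close>

lemma koebe_rotation_class_U:
  assumes x: "cmod x = 1"
  shows "koebe_rotation x \<in> class_U"
proof -
  have nz: "1 - x * z \<noteq> 0" if "z \<in> \<D>" for z
  proof
    assume "1 - x * z = 0"
    hence "cmod (x * z) = 1" by simp
    thus False using x that by (simp add: norm_mult)
  qed
  have der: "(koebe_rotation x has_field_derivative (1 + x * z) / (1 - x * z) ^ 3) (at z)"
    if "z \<in> \<D>" for z
    unfolding koebe_rotation_def
    by (rule derivative_eq_intros refl)+
       (use nz[OF that] in \<open>simp_all add: divide_simps, algebra\<close>)
  hence "koebe_rotation x holomorphic_on \<D>"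
    unfolding holomorphic_on_open[OF open_ball] by blast
  hence "koebe_rotation x \<in> class_A"
    using DERIV_imp_deriv[OF der[of 0]]
    by (simp add: class_A_def analytic_on_open koebe_rotation_def)
  moreover have "koebe_rotation x z \<noteq> 0" if "z \<in> \<D> - {0}" for z
    using nz[of z] that by (simp add: koebe_rotation_def)
  moreover have "cmod (deriv (koebe_rotation x) z * (z_over (koebe_rotation x) z)\<^sup>2 - 1) < 1"
    if z: "z \<in> \<D>" for z
  proof -
    have "z_over (koebe_rotation x) z = (1 - x * z)\<^sup>2"
      using nz[OF z] by (simp add: z_over_def koebe_rotation_def)
    hence "deriv (koebe_rotation x) z * (z_over (koebe_rotation x) z)\<^sup>2 =
             (1 + x * z) / (1 - x * z) ^ 3 * (1 - x * z) ^ 4"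
      using DERIV_imp_deriv[OF der[OF z]] by simp
    also have "\<dots> = (1 + x * z) * (1 - x * z)" using nz[OF z] by (simp add: eval_nat_numeral)
    finally have "deriv (koebe_rotation x) z * (z_over (koebe_rotation x) z)\<^sup>2 - 1 = - ((x * z)\<^sup>2)"
      by (simp add: power2_eq_square algebra_simps)
    thus ?thesis using x z by (simp add: norm_mult norm_power abs_square_less_1)
  qed
  ultimately show ?thesis by (simp add: class_U_def)
qed

lemma koebe_rotation_expansion:
  assumes x: "cmod x = 1"
  shows "has_expansion (koebe_rotation x) (\<lambda>n. of_nat n * x ^ (n - 1))"
  unfolding has_expansion_def
proof
  fix z :: complex assume z: "z \<in> \<D>"
  have "(\<lambda>n. of_nat (Suc n) * (x * z) ^ n) sums (1 / (1 - x * z)\<^sup>2)"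
    using x z by (intro geometric_deriv_sums) (simp add: norm_mult)
  hence "(\<lambda>n. z * (of_nat (Suc n) * (x * z) ^ n)) sums (z * (1 / (1 - x * z)\<^sup>2))"
    by (rule sums_mult)
  hence "(\<lambda>n. z * (of_nat (Suc (n + 1)) * (x * z) ^ (n + 1))) sums
           (z * (1 / (1 - x * z)\<^sup>2) - (\<Sum>n<1. z * (of_nat (Suc n) * (x * z) ^ n)))"
    by (rule sums_split_initial_segment)
  thus "(\<lambda>n. of_nat (n + 2) * x ^ (n + 2 - 1) * z ^ (n + 2)) sums (koebe_rotation x z - z)"
    by (simp add: koebe_rotation_def power_mult_distrib mult_ac)
qed

theorem theorem3p4:
  "(\<forall>f\<in>class_U. \<forall>a. has_expansion f a \<longrightarrow>
      (\<forall>n\<ge>2. cmod ((a n)\<^sup>2 - a (2 * n - 1)) \<le> (real n - 1)\<^sup>2)) \<and>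
   (\<forall>x. cmod x = 1 \<longrightarrow>
      koebe_rotation x \<in> class_U \<and>
      (\<exists>b. has_expansion (koebe_rotation x) b \<and>
        (\<forall>n\<ge>2. cmod ((b n)\<^sup>2 - b (2 * n - 1)) = (real n - 1)\<^sup>2)))"
proof -
  have "cmod ((of_nat n * x ^ (n - 1))\<^sup>2 - of_nat (2 * n - 1) * x ^ (2 * n - 1 - 1)) =
        (real n - 1)\<^sup>2" if x: "cmod x = 1" and n: "n \<ge> 2" for x n
  proof -
    have "2 * n - 1 - 1 = (n - 1) * 2" using n by simp
    hence "x ^ (2 * n - 1 - 1) = (x ^ (n - 1))\<^sup>2" by (simp only: power_mult)
    hence "(of_nat n * x ^ (n - 1))\<^sup>2 - of_nat (2 * n - 1) * x ^ (2 * n - 1 - 1) =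
        of_real ((real n - 1)\<^sup>2) * (x ^ (n - 1))\<^sup>2"
      using n by (simp only: power_mult_distrib) (simp add: of_nat_diff power2_eq_square algebra_simps)
    hence "cmod ((of_nat n * x ^ (n - 1))\<^sup>2 - of_nat (2 * n - 1) * x ^ (2 * n - 1 - 1)) =
        cmod (of_real ((real n - 1)\<^sup>2)) * cmod ((x ^ (n - 1))\<^sup>2)"
      by (simp only: norm_mult)
    thus ?thesis unfolding norm_of_real using x by (simp add: norm_power)
  qed
  with class_U_zalcman koebe_rotation_class_U koebe_rotation_expansion show ?thesis
    by (metis (no_types, lifting))
qed

end
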